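(* Let $\mathcal{K}$ be a finite simplicial complex in $\mathbb{R}^d$ with vertex set $V\subset\mathbb{R}^d$, let $k$ be a homology degree with $0\le k\le d$, and let $a\in\mathbb{R}^d$. Let $\mathcal{K}+a$ be the translate of $\mathcal{K}$, i.e. the simplicial complex with vertex set $V+a=\{x+a:x\in V\}$ whose simplices are the translates by $a$ of the simplices of $\mathcal{K}$. Then $$\mathrm{PET}^{(k)}_{\mathcal{K}+a}=\mathrm{PET}^{(k)}_{\mathcal{K}}$$ as functions on $S^{d-1}$.
   Context: A simplicial complex $\mathcal{K}$ in $\mathbb{R}^d$ with finite vertex set $V\subset\mathbb{R}^d$ is a finite collection of simplices (convex hulls of affinely independent subsets of $V$) closed under taking faces and such that any two simplices intersect in a common face or not at all. For $v\in S^{d-1}$ (the unit sphere in $\mathbb{R}^d$), the directional height function is $f_v:V\to\mathbb{R}$, $f_v(x)=\langle x,v\rangle$. Its lower-star filtration assigns to each simplex the maximum of $f_v$ over its vertices; the sublevel complex at $t$ is $\{\sigma\in\mathcal{K}:\max_{x\in\sigma}f_v(x)\le t\}$. $D_k(f_v)$ is the $k$-dimensional persistence diagram (persistent homology with coefficients in a fixed field) of this filtration, a finite multiset of pairs $(b_i,d_i)$, $i\in I$, with $b_i\le d_i$ finite; classes that never die are assigned death time $\max_{x\in V} f_v(x)$. Persistent entropy of a finite diagram $D=\{(b_i,d_i)\}_{i\in I}$: with $\ell_i=d_i-b_i$, $L=\sum_{i\in I}\ell_i$ and $p_i=\ell_i/L$, one sets $\mathrm{PE}(D)=-\sum_{i\in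 I}p_i\log p_i$, where $\log$ is the natural logarithm and $0\log 0=0$; if $D$ is empty or $L=0$, then $\mathrm{PE}(D)=0$. The persistent entropy transform of $\mathcal{K}$ in homology degree $k$ is the function $\mathrm{PET}^{(k)}_{\mathcal{K}}:S^{d-1}\to\mathbb{R}$, $v\mapsto \mathrm{PE}(D_k(f_v))$. *)

theory Defs
  imports "HOL-Analysis.Analysis" "HOL-Library.Function_Algebras" "HOL-Library.Set_Algebras"
    "HOL-Library.Multiset"
begin

section \<open>Geometric simplicial complexes\<close>

definition vertices :: "'a::euclidean_space set \<Rightarrow> 'a set"
  where "vertices S = {x. x extreme_point_of S}"

lemma vertices_simplex: "\<not> affine_dependent C \<Longrightarrow> vertices (convex hull C) = C"
  by (simp add: vertices_def extreme_point_of_convex_hull_affine_independent)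

text \<open>
  In the library's \<^const>\<open>simplicial_complex\<close> the empty set is a face of every simplex, so it belongs
  to every nonempty complex, as a simplex of dimension \<open>-1\<close>. It plays no role below, as homology is
  taken unreduced and in degrees \<open>k \<ge> 0\<close>.
\<close>

definition simplicial_complex_on :: "'a::euclidean_space set \<Rightarrow> 'a set set \<Rightarrow> bool"
  where "simplicial_complex_on V K \<longleftrightarrow>
    finite V \<and> simplicial_complex K \<and>
    (\<forall>S\<in>K. \<exists>C\<subseteq>V. \<not> affine_dependent C \<and> S = convex hull C)"

section \<open>Simplicial homology with coefficients in a field\<close>

text \<open>
  Oriented chains: a \<open>k\<close>-chain assigns a coefficient to every ordering \<open>[x\<^sub>0, \<dots>, x\<^sub>k]\<close> of the vertices
  of a \<open>k\<close>-simplex, and changes by the sign of the permutation when the vertices are reordered.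
\<close>

definition ordered_simplices :: "nat \<Rightarrow> 'a::euclidean_space set set \<Rightarrow> 'a list set"
  where "ordered_simplices k K =
    {xs. length xs = Suc k \<and> distinct xs \<and> (\<exists>S\<in>K. set xs = vertices S)}"

definition chains :: "nat \<Rightarrow> 'a::euclidean_space set set \<Rightarrow> ('a list \<Rightarrow> 'f::field) set"
  where "chains k K =
    {c. (\<forall>xs. xs \<notin> ordered_simplices k K \<longrightarrow> c xs = 0) \<and>
        (\<forall>xs\<in>ordered_simplices k K. \<forall>\<pi>. \<pi> permutes {..<length xs} \<longrightarrow>
           c (permute_list \<pi> xs) = of_int (sign \<pi>) * c xs)}"

text \<open>
  The linear map with \<open>\<partial>[x\<^sub>0, \<dots>, x\<^sub>k] = (\<Sum>i\<le>k. (-1)^i [x\<^sub>0, \<dots>, x\<^sub>k without x\<^sub>i])\<close>, and \<open>\<partial> = 0\<close> on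
  \<open>0\<close>-chains: bringing \<open>x\<^sub>i\<close> to the front costs the sign \<open>(-1)^i\<close>, so the coefficient of \<open>\<partial>c\<close> at \<open>ys\<close>
  collects the coefficients of \<open>c\<close> at all \<open>x # ys\<close>.
\<close>

definition boundary :: "nat \<Rightarrow> ('a list \<Rightarrow> 'f::field) \<Rightarrow> 'a list \<Rightarrow> 'f"
  where "boundary k c = (if k = 0 then 0 else (\<lambda>ys. \<Sum>x | c (x # ys) \<noteq> 0. c (x # ys)))"

definition cycles :: "nat \<Rightarrow> 'a::euclidean_space set set \<Rightarrow> ('a list \<Rightarrow> 'f::field) set"
  where "cycles k K = {c \<in> chains k K. boundary k c = 0}"

definition boundaries :: "nat \<Rightarrow> 'a::euclidean_space set set \<Rightarrow> ('a list \<Rightarrow> 'f::field) set"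
  where "boundaries k K = boundary (Suc k) ` chains (Suc k) K"

definition homology :: "nat \<Rightarrow> 'a::euclidean_space set set \<Rightarrow> ('a list \<Rightarrow> 'f::field) set set"
  where "homology k K = (\<lambda>z. z +o boundaries k K) ` cycles k K"

text \<open>The map into the homology of \<open>L\<close> induced by the inclusion of a subcomplex of \<open>L\<close>:
  it sends \<open>z + B\<^sub>k(K)\<close> to \<open>z + B\<^sub>k(L)\<close>.\<close>

definition homology_inclusion ::
    "nat \<Rightarrow> 'a::euclidean_space set set \<Rightarrow> ('a list \<Rightarrow> 'f::field) set \<Rightarrow> ('a list \<Rightarrow> 'f) set"
  where "homology_inclusion k L C = C + boundaries k L"

text \<open>
  Linear independence in the quotient space by the subspace \<open>W\<close> of a finite set of cosets of \<open>W\<close>.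
  Adding \<open>W\<close> to the linear combination matters if all coefficients are \<open>0\<close>: the sum of
  sets is then \<open>{0}\<close>, but the zero vector of the quotient is \<open>W\<close>.
\<close>

definition independent_cosets :: "('b \<Rightarrow> 'f::field) set \<Rightarrow> ('b \<Rightarrow> 'f) set set \<Rightarrow> bool"
  where "independent_cosets W S \<longleftrightarrow>
    (\<forall>a. W + (\<Sum>C\<in>S. (\<lambda>c x. a C * c x) ` C) = W \<longrightarrow> (\<forall>C\<in>S. a C = 0))"

definition dim_cosets :: "('b \<Rightarrow> 'f::field) set \<Rightarrow> ('b \<Rightarrow> 'f) set set \<Rightarrow> nat"
  where "dim_cosets W Q = Max (card ` {S. S \<subseteq> Q \<and> finite S \<and> independent_cosets W S})"

definition persistent_betti ::
    "'f::field itself \<Rightarrow> nat \<Rightarrow> 'a::euclidean_space set set \<Rightarrow> 'a set set \<Rightarrow> nat"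
  where "persistent_betti F k K L =
    dim_cosets (boundaries k L :: ('a list \<Rightarrow> 'f) set) (homology_inclusion k L ` homology k K)"

section \<open>Lower-star filtrations and their persistence diagrams\<close>

definition lower_star :: "('a::euclidean_space \<Rightarrow> real) \<Rightarrow> 'a set \<Rightarrow> real"
  where "lower_star f S = Max (f ` vertices S)"

definition sublevel :: "'a::euclidean_space set set \<Rightarrow> ('a \<Rightarrow> real) \<Rightarrow> real \<Rightarrow> 'a set set"
  where "sublevel K f t = {S\<in>K. S = {} \<or> lower_star f S \<le> t}"

text \<open>For a filtration value \<open>t\<close>, the complex that precedes \<open>sublevel K f t\<close> in the filtration.\<close>

definition strict_sublevel :: "'a::euclidean_space set set \<Rightarrow> ('a \<Rightarrow> real) \<Rightarrow> real \<Rightarrow> 'a set set"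
  where "strict_sublevel K f t = {S\<in>K. S = {} \<or> lower_star f S < t}"

text \<open>
  The number of \<open>k\<close>-dimensional classes born at \<open>s\<close> and dying at \<open>t > s\<close>, respectively born at \<open>s\<close> and
  never dying, by inclusion-exclusion on persistent Betti numbers.
\<close>

definition finite_multiplicity ::
    "'f::field itself \<Rightarrow> nat \<Rightarrow> 'a::euclidean_space set set \<Rightarrow> ('a \<Rightarrow> real) \<Rightarrow> real \<Rightarrow> real \<Rightarrow> nat"
  where "finite_multiplicity F k K f s t =
    nat ((int (persistent_betti F k (sublevel K f s) (strict_sublevel K f t))
          - int (persistent_betti F k (sublevel K f s) (sublevel K f t)))
       - (int (persistent_betti F k (strict_sublevel K f s) (strict_sublevel K f t))
          - int (persistent_betti F k (strict_sublevel K f s) (sublevel K f t))))"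

definition essential_multiplicity ::
    "'f::field itself \<Rightarrow> nat \<Rightarrow> 'a::euclidean_space set set \<Rightarrow> ('a \<Rightarrow> real) \<Rightarrow> real \<Rightarrow> nat"
  where "essential_multiplicity F k K f s =
    nat (int (persistent_betti F k (sublevel K f s) K)
       - int (persistent_betti F k (strict_sublevel K f s) K))"

definition persistence_diagram ::
    "'f::field itself \<Rightarrow> nat \<Rightarrow> 'a::euclidean_space set \<Rightarrow> 'a set set \<Rightarrow> ('a \<Rightarrow> real)
      \<Rightarrow> (real \<times> real) multiset"
  where "persistence_diagram F k V K f =
    (\<Sum>s\<in>f ` V. \<Sum>t\<in>{t\<in>f ` V. s < t}. replicate_mset (finite_multiplicity F k K f s t) (s, t))
    + (\<Sum>s\<in>f ` V. replicate_mset (essential_multiplicity F k K f s) (s, Max (f ` V)))"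

section \<open>Persistent entropy\<close>

text \<open>The convention \<open>0 log 0 = 0\<close> holds in HOL.\<close>

definition persistent_entropy :: "(real \<times> real) multiset \<Rightarrow> real"
  where "persistent_entropy D =
    (let L = (\<Sum>(b, d)\<in>#D. d - b)
     in if L = 0 then 0 else - (\<Sum>(b, d)\<in>#D. (d - b) / L * ln ((d - b) / L)))"

definition PET ::
    "'f::field itself \<Rightarrow> nat \<Rightarrow> 'a::euclidean_space set \<Rightarrow> 'a set set \<Rightarrow> 'a \<Rightarrow> real"
  where "PET F k V K =
    (\<lambda>v\<in>sphere 0 1. persistent_entropy (persistence_diagram F k V K (\<lambda>x. x \<bullet> v)))"

section \<open>Translates\<close>

definition translate_complex :: "'a::euclidean_space \<Rightarrow> 'a set set \<Rightarrow> 'a set set"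
  where "translate_complex a K = (\<lambda>S. (\<lambda>x. x + a) ` S) ` K"

lemma simplicial_complex_on_translate:
  assumes "simplicial_complex_on V K"
  shows "simplicial_complex_on ((\<lambda>x. x + a) ` V) (translate_complex a K)"
proof -
  have tr: "(\<lambda>x. x + a) = (+) a" by (rule ext) (rule add.commute)
  have hull: "\<exists>D\<subseteq>(+) a ` V. \<not> affine_dependent D \<and> (+) a ` S = convex hull D" if "S \<in> K" for S
  proof -
    have "\<exists>C\<subseteq>V. \<not> affine_dependent C \<and> S = convex hull C"
      using assms that unfolding simplicial_complex_on_def by simp
    then obtain C where C: "C \<subseteq> V" "\<not> affine_dependent C" "S = convex hull C" by (elim exE conjE)
    have "\<not> affine_dependent ((+) a ` C)"
      using C(2) affine_dependent_translation_eq[of C a] by simp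
    moreover have "(+) a ` S = convex hull ((+) a ` C)"
      unfolding C(3) by (rule convex_hull_translation[symmetric])
    ultimately show ?thesis using image_mono[OF C(1)] by metis
  qed
  have face: "F \<in> (`) ((+) a) ` K" if SF: "S \<in> K" "F face_of (+) a ` S" for F S
  proof -
    obtain T where T: "F = (+) a ` T" using face_of_imp_subset[OF SF(2)] by (meson subset_imageE)
    then have "T face_of S" using SF(2) by simp
    then have "T \<in> K" using SF(1) assms
      unfolding simplicial_complex_on_def simplicial_complex_def by meson
    then show ?thesis using T by blast
  qed
  have inter: "((+) a ` S \<inter> (+) a ` T) face_of (+) a ` S" if "S \<in> K" "T \<in> K" for S T
  proof -
    have "(S \<inter> T) face_of S"
      using that assms unfolding simplicial_complex_on_def simplicial_complex_def by meson
    then have "(+) a ` (S \<inter> T) face_of (+) a ` S" by simp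
    then show ?thesis by (simp only: translation_Int)
  qed
  have dim: "\<exists>n. n simplex (+) a ` S" if S: "S \<in> K" for S
  proof -
    obtain D where "\<not> affine_dependent D" "(+) a ` S = convex hull D" using hull[OF S] by blast
    then show ?thesis
      unfolding simplex_def by (intro exI[of _ "int (card D) - 1"] exI[of _ D]) simp
  qed
  have fin: "finite V" "finite K"
    using assms unfolding simplicial_complex_on_def simplicial_complex_def by meson+
  have "simplicial_complex ((`) ((+) a) ` K)"
    unfolding simplicial_complex_def
  proof (intro conjI ballI allI impI)
    show "finite ((`) ((+) a) ` K)" using fin(2) by (rule finite_imageI)
    show "\<exists>n. n simplex T" if "T \<in> (`) ((+) a) ` K" for T
      using that dim by (elim imageE) simp
    show "F \<in> (`) ((+) a) ` K" if "T \<in> (`) ((+) a) ` K \<and> F face_of T" for F T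
      using that face by (elim conjE imageE) simp
    show "(T \<inter> T') face_of T" if "T \<in> (`) ((+) a) ` K \<and> T' \<in> (`) ((+) a) ` K" for T T'
      using that inter by (elim conjE imageE) simp
  qed
  moreover have "\<forall>T\<in>(`) ((+) a) ` K. \<exists>D\<subseteq>(+) a ` V. \<not> affine_dependent D \<and> T = convex hull D"
    using hull by (intro ballI, elim imageE) simp
  ultimately show ?thesis
    unfolding simplicial_complex_on_def translate_complex_def tr
    using finite_imageI[OF fin(1)] by blast
qed

end

theory Submission
  imports Defs
begin

text \<open>
  For a unit vector \<open>v\<close>, translation by \<open>a\<close> adds the constant \<open>h = a \<bullet> v\<close> to the height of every
  vertex. Hence the sublevel complex of the translate at \<open>t + h\<close> is the translate of the sublevel
  complex at \<open>t\<close>. Moving chains along with their vertices is a linear isomorphism of chain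
  complexes that respects inclusions of subcomplexes, so corresponding persistent Betti numbers
  agree (\<open>persistent_betti_translate\<close>), and with them the multiplicities of the points of the
  diagram. The diagram of the translate is therefore the original one, shifted by \<open>(h, h)\<close>
  (\<open>persistence_diagram_translate\<close>). Persistent entropy sees only the differences
  \<open>d - b\<close>, which such a shift does not change.
\<close>

section \<open>Linear invariance of the dimension of a family of cosets\<close>

lemma image_set_plus:
  fixes \<phi> :: "'a::plus \<Rightarrow> 'b::plus"
  assumes "\<And>x y. \<phi> (x + y) = \<phi> x + \<phi> y"
  shows "\<phi> ` (A + B) = \<phi> ` A + \<phi> ` B"
  unfolding set_plus_image image_image by (force simp: assms)

lemma image_elt_set_plus:
  fixes \<phi> :: "'a::plus \<Rightarrow> 'b::plus"
  assumes "\<And>x y. \<phi> (x + y) = \<phi> x + \<phi> y"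
  shows "\<phi> ` (z +o B) = \<phi> z +o \<phi> ` B"
  unfolding elt_set_plus_def by (force simp: assms)

lemma image_set_sum:
  fixes \<phi> :: "'a::comm_monoid_add \<Rightarrow> 'b::comm_monoid_add"
  assumes "\<phi> 0 = 0" "\<And>x y. \<phi> (x + y) = \<phi> x + \<phi> y"
  shows "\<phi> ` (\<Sum>i\<in>I. A i) = (\<Sum>i\<in>I. \<phi> ` A i)"
  by (induction I rule: infinite_finite_induct)
    (simp_all add: image_set_plus[where \<phi> = \<phi>, OF assms(2)] set_zero assms(1))

text \<open>
  A linear \<open>\<phi>\<close> commutes with the set-level linear combinations by which independence of cosets is
  expressed, so a relation among the images \<open>\<phi> ` C\<close> is the image of the relation among the \<open>C\<close>
  with the same coefficients; injectivity lets \<open>\<phi>\<close> be cancelled from the latter.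
\<close>

lemma independent_cosets_image_iff:
  fixes \<phi> :: "('b \<Rightarrow> 'f::field) \<Rightarrow> ('c \<Rightarrow> 'f)"
  assumes inj: "inj \<phi>"
    and add: "\<And>c d. \<phi> (c + d) = \<phi> c + \<phi> d"
    and scale: "\<And>r c. \<phi> (\<lambda>x. r * c x) = (\<lambda>x. r * \<phi> c x)"
  shows "independent_cosets (\<phi> ` W) ((`) \<phi> ` S) \<longleftrightarrow> independent_cosets W S"
proof -
  have zero: "\<phi> 0 = 0"
    using scale[of 0 0] by (simp add: zero_fun_def)
  have injs: "inj ((`) \<phi>)"
    using inj by (simp add: inj_image_eq_iff inj_def)
  have comb: "\<phi> ` W + (\<Sum>C\<in>(`) \<phi> ` S. (\<lambda>c x. r C * c x) ` C)
      = \<phi> ` (W + (\<Sum>C\<in>S. (\<lambda>c x. r (\<phi> ` C) * c x) ` C))" for r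
  proof -
    have "(\<Sum>C\<in>(`) \<phi> ` S. (\<lambda>c x. r C * c x) ` C)
        = (\<Sum>C\<in>S. (\<lambda>c x. r (\<phi> ` C) * c x) ` \<phi> ` C)"
      using injs by (subst sum.reindex) (auto intro: inj_on_subset)
    also have "\<dots> = (\<Sum>C\<in>S. \<phi> ` (\<lambda>c x. r (\<phi> ` C) * c x) ` C)"
      by (simp add: image_image scale)
    also have "\<dots> = \<phi> ` (\<Sum>C\<in>S. (\<lambda>c x. r (\<phi> ` C) * c x) ` C)"
      by (rule image_set_sum[where \<phi> = \<phi>, OF zero add, symmetric])
    finally show ?thesis
      by (simp add: image_set_plus[where \<phi> = \<phi>, OF add])
  qed
  have comb_eq: "\<phi> ` W + (\<Sum>C\<in>(`) \<phi> ` S. (\<lambda>c x. r C * c x) ` C) = \<phi> ` W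
      \<longleftrightarrow> W + (\<Sum>C\<in>S. (\<lambda>c x. r (\<phi> ` C) * c x) ` C) = W" for r
    unfolding comb by (rule inj_image_eq_iff[OF inj])
  show ?thesis
  proof
    assume indep: "independent_cosets (\<phi> ` W) ((`) \<phi> ` S)"
    show "independent_cosets W S"
      unfolding independent_cosets_def
    proof (intro allI impI ballI)
      fix r C
      assume eq: "W + (\<Sum>C\<in>S. (\<lambda>c x. r C * c x) ` C) = W" and "C \<in> S"
      \<comment> \<open>The coefficient of \<open>C\<close> has to become the coefficient of \<open>\<phi> ` C\<close>.\<close>
      define r' where "r' = r \<circ> inv ((`) \<phi>)"
      have r': "r' (\<phi> ` C) = r C" for C
        by (simp add: r'_def inv_f_f[OF injs])
      have "\<phi> ` W + (\<Sum>C\<in>(`) \<phi> ` S. (\<lambda>c x. r' C * c x) ` C) = \<phi> ` W"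
        unfolding comb_eq r' by (rule eq)
      with indep have "\<forall>C\<in>(`) \<phi> ` S. r' C = 0"
        unfolding independent_cosets_def by blast
      with \<open>C \<in> S\<close> show "r C = 0"
        by (simp add: r')
    qed
  next
    assume indep: "independent_cosets W S"
    show "independent_cosets (\<phi> ` W) ((`) \<phi> ` S)"
      unfolding independent_cosets_def
    proof (intro allI impI)
      fix r
      assume "\<phi> ` W + (\<Sum>C\<in>(`) \<phi> ` S. (\<lambda>c x. r C * c x) ` C) = \<phi> ` W"
      then have eq: "W + (\<Sum>C\<in>S. (\<lambda>c x. r (\<phi> ` C) * c x) ` C) = W"
        by (simp only: comb_eq)
      have "\<forall>C\<in>S. r (\<phi> ` C) = 0"
        using indep[unfolded independent_cosets_def, rule_format, OF eq] by blast
      then show "\<forall>C\<in>(`) \<phi> ` S. r C = 0"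
        by simp
    qed
  qed
qed

text \<open>
  The independent finite subfamilies on the two sides correspond under \<open>S \<mapsto> (`) \<phi> ` S\<close>, which keeps
  cardinalities, so the maxima are taken over the same set of numbers.
\<close>

lemma dim_cosets_image:
  fixes \<phi> :: "('b \<Rightarrow> 'f::field) \<Rightarrow> ('c \<Rightarrow> 'f)"
  assumes inj: "inj \<phi>"
    and add: "\<And>c d. \<phi> (c + d) = \<phi> c + \<phi> d"
    and scale: "\<And>r c. \<phi> (\<lambda>x. r * c x) = (\<lambda>x. r * \<phi> c x)"
  shows "dim_cosets (\<phi> ` W) ((`) \<phi> ` Q) = dim_cosets W Q"
proof -
  have injs: "inj ((`) \<phi>)"
    using inj by (simp add: inj_image_eq_iff inj_def)
  have inj_on: "inj_on ((`) \<phi>) S" for S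
    using injs by (rule inj_on_subset) simp
  have fin: "finite ((`) \<phi> ` S) \<longleftrightarrow> finite S" for S
    by (rule finite_image_iff[OF inj_on])
  have "{S. S \<subseteq> (`) \<phi> ` Q \<and> finite S \<and> independent_cosets (\<phi> ` W) S}
      = (`) ((`) \<phi>) ` {S. S \<subseteq> Q \<and> finite S \<and> independent_cosets W S}" (is "?L = ?R")
  proof
    show "?L \<subseteq> ?R"
    proof
      fix S' assume S': "S' \<in> ?L"
      then obtain S where S: "S \<subseteq> Q" "S' = (`) \<phi> ` S"
        by (auto elim: subset_imageE)
      with S' have "finite S" "independent_cosets W S"
        using fin independent_cosets_image_iff[where \<phi> = \<phi>, OF assms] by auto
      with S show "S' \<in> ?R" by blast
    qed
    show "?R \<subseteq> ?L"
      using fin independent_cosets_image_iff[where \<phi> = \<phi>, OF assms] by auto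
  qed
  then show ?thesis
    unfolding dim_cosets_def by (simp add: image_image card_image[OF inj_on])
qed

section \<open>Persistent Betti numbers of translated complexes\<close>

text \<open>The pushforward of a chain along \<open>x \<mapsto> x + a\<close>; a chain is a coefficient function, so this is
  precomposition with the inverse map.\<close>

definition translate_chain :: "'a::euclidean_space \<Rightarrow> ('a list \<Rightarrow> 'f) \<Rightarrow> 'a list \<Rightarrow> 'f"
  where "translate_chain a c = (\<lambda>xs. c (map (\<lambda>x. x - a) xs))"

lemma translate_chain_inverse:
  "translate_chain a (translate_chain (- a) c) = c"
  by (simp add: translate_chain_def comp_def)

lemma inj_translate_chain: "inj (translate_chain a)"
  by (rule inj_on_inverseI[where g = "translate_chain (- a)"])
    (use translate_chain_inverse[of "- a"] in simp)

lemma translate_chain_zero: "translate_chain a 0 = 0"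
  by (simp add: translate_chain_def zero_fun_def)

lemma translate_chain_add:
  "translate_chain a (c + d) = translate_chain a c + translate_chain a d"
  by (simp add: translate_chain_def plus_fun_def)

lemma translate_chain_scale:
  "translate_chain a (\<lambda>xs. r * c xs) = (\<lambda>xs. r * translate_chain a c xs)"
  by (simp add: translate_chain_def)

lemma translate_complex_inverse: "translate_complex (- a) (translate_complex a K) = K"
  by (simp add: translate_complex_def image_image)

lemma vertices_translate: "vertices ((\<lambda>x. x + a) ` S) = (\<lambda>x. x + a) ` vertices S"
proof -
  have tr: "(\<lambda>x. x + a) = (+) a" by (rule ext) (rule add.commute)
  have "a + x \<in> vertices ((+) a ` S) \<longleftrightarrow> x \<in> vertices S" for x
    by (simp add: vertices_def extreme_point_of_translation_eq)
  from this[of "y - a" for y] have "y \<in> vertices ((+) a ` S) \<longleftrightarrow> y \<in> (+) a ` vertices S" for y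
    by (force simp: image_iff)
  then show ?thesis unfolding tr by blast
qed

lemma ordered_simplices_translate:
  "map (\<lambda>x. x - a) xs \<in> ordered_simplices k K
    \<longleftrightarrow> xs \<in> ordered_simplices k (translate_complex a K)"
proof -
  have "(\<lambda>x. x - a) ` set xs = A \<longleftrightarrow> set xs = (\<lambda>x. x + a) ` A" for A
    by (auto simp: image_image)
  moreover have "distinct (map (\<lambda>x. x - a) xs) \<longleftrightarrow> distinct xs"
    by (simp add: distinct_map)
  ultimately show ?thesis
    by (simp add: ordered_simplices_def translate_complex_def vertices_translate)
qed

lemma translate_chain_in_chains:
  assumes "c \<in> chains k K"
  shows "translate_chain a c \<in> chains k (translate_complex a K)"
proof -
  have "translate_chain a c xs = 0" if "xs \<notin> ordered_simplices k (translate_complex a K)" for xs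
    using assms that by (simp add: chains_def translate_chain_def ordered_simplices_translate)
  moreover have "translate_chain a c (permute_list \<pi> xs) = of_int (sign \<pi>) * translate_chain a c xs"
    if xs: "xs \<in> ordered_simplices k (translate_complex a K)" and \<pi>: "\<pi> permutes {..<length xs}"
    for xs \<pi>
  proof -
    have "map (\<lambda>x. x - a) xs \<in> ordered_simplices k K"
      using xs by (simp only: ordered_simplices_translate)
    moreover have "\<pi> permutes {..<length (map (\<lambda>x. x - a) xs)}"
      using \<pi> by simp
    ultimately have "c (permute_list \<pi> (map (\<lambda>x. x - a) xs))
        = of_int (sign \<pi>) * c (map (\<lambda>x. x - a) xs)"
      using assms unfolding chains_def by blast
    then show ?thesis
      by (simp only: translate_chain_def permute_list_map[OF \<pi>])
  qed
  ultimately show ?thesis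
    unfolding chains_def by blast
qed

text \<open>One inclusion suffices, for all complexes and all \<open>a\<close>: the other one is its instance for the
  inverse translation.\<close>

lemma chains_translate:
  "chains k (translate_complex a K) = translate_chain a ` chains k K"
proof
  show "chains k (translate_complex a K) \<subseteq> translate_chain a ` chains k K"
  proof
    fix c :: "'a list \<Rightarrow> 'f::field" assume "c \<in> chains k (translate_complex a K)"
    then have "translate_chain (- a) c \<in> chains k K"
      using translate_chain_in_chains[of c k _ "- a"] by (metis translate_complex_inverse)
    then show "c \<in> translate_chain a ` chains k K"
      by (metis translate_chain_inverse imageI)
  qed
qed (use translate_chain_in_chains in blast)

lemma boundary_translate:
  "boundary k (translate_chain a c) = translate_chain a (boundary k c)"
proof -
  have "(\<Sum>x | c ((x - a) # zs) \<noteq> 0. c ((x - a) # zs)) = (\<Sum>x | c (x # zs) \<noteq> 0. c (x # zs))" for zs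
    by (rule sum.reindex_bij_witness[where i = "\<lambda>x. x + a" and j = "\<lambda>x. x - a"]) auto
  then show ?thesis
    by (simp add: boundary_def translate_chain_def zero_fun_def)
qed

lemma cycles_translate:
  "cycles k (translate_complex a K) = translate_chain a ` cycles k K"
proof -
  have "translate_chain a c = 0 \<longleftrightarrow> c = 0" for c :: "'a list \<Rightarrow> 'f::field"
    using inj_eq[OF inj_translate_chain, of a c 0] by (simp add: translate_chain_zero)
  then have "boundary k (translate_chain a c) = 0 \<longleftrightarrow> boundary k c = 0"
    for c :: "'a list \<Rightarrow> 'f::field"
    by (simp only: boundary_translate)
  then show ?thesis
    unfolding cycles_def chains_translate by blast
qed

lemma boundaries_translate:
  "boundaries k (translate_complex a K) = translate_chain a ` boundaries k K"
  by (simp add: boundaries_def chains_translate image_image boundary_translate)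

lemma homology_translate:
  "homology k (translate_complex a K) = (`) (translate_chain a) ` homology k K"
  by (simp add: homology_def cycles_translate boundaries_translate image_image
      image_elt_set_plus[where \<phi> = "translate_chain a", OF translate_chain_add])

text \<open>
  The persistent Betti number is the dimension of a family of cosets of the boundaries of \<open>L\<close>.
  Translating both complexes replaces the subspace and every coset by its image under one and the
  same injective linear map, which also commutes with adding the boundaries of \<open>L\<close>.
\<close>

lemma persistent_betti_translate:
  "persistent_betti F k (translate_complex a K) (translate_complex a L) = persistent_betti F k K L"
  unfolding persistent_betti_def homology_translate boundaries_translate image_image
    homology_inclusion_def
    image_set_plus[where \<phi> = "translate_chain a", OF translate_chain_add, symmetric]
  using dim_cosets_image[where \<phi> = "translate_chain a",
      OF inj_translate_chain translate_chain_add translate_chain_scale,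
      of "boundaries k L" "(\<lambda>C. C + boundaries k L) ` homology k K"]
  by (simp add: image_image)

section \<open>The persistence diagram of a translate\<close>

text \<open>The maximum of \<open>f\<close> over the vertices behaves as expected only if these are finite in number and
  exist at all, as is the case for a simplex other than the empty one.\<close>

lemma lower_star_translate:
  assumes "\<And>x. f (x + a) = f x + h" "finite (vertices S)" "vertices S \<noteq> {}"
  shows "lower_star f ((\<lambda>x. x + a) ` S) = lower_star f S + h"
  using assms Max_add_commute[of "vertices S" f h]
  by (simp add: lower_star_def vertices_translate image_image)

lemma vertices_of_simplicial_complex:
  assumes "simplicial_complex_on V K" "S \<in> K" "S \<noteq> {}"
  shows "finite (vertices S)" "vertices S \<noteq> {}"
proof -
  obtain C where C: "C \<subseteq> V" "\<not> affine_dependent C" "S = convex hull C"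
    using assms unfolding simplicial_complex_on_def by blast
  then show "finite (vertices S)" "vertices S \<noteq> {}"
    using assms(3) aff_independent_finite[OF C(2)] by (auto simp: vertices_simplex)
qed

lemma sublevel_translate:
  assumes "simplicial_complex_on V K" "\<And>x. f (x + a) = f x + h"
  shows "sublevel (translate_complex a K) f (t + h) = translate_complex a (sublevel K f t)"
    and "strict_sublevel (translate_complex a K) f (t + h)
      = translate_complex a (strict_sublevel K f t)"
proof -
  have shift: "lower_star f ((\<lambda>x. x + a) ` S) = lower_star f S + h" if "S \<in> K" "S \<noteq> {}" for S
    using assms(2) vertices_of_simplicial_complex[OF assms(1) that] by (rule lower_star_translate)
  have "(\<lambda>x. x + a) ` S = {} \<or> lower_star f ((\<lambda>x. x + a) ` S) \<le> t + h
      \<longleftrightarrow> S = {} \<or> lower_star f S \<le> t" if "S \<in> K" for S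
    using shift[OF that] by (cases "S = {}") simp_all
  then show "sublevel (translate_complex a K) f (t + h) = translate_complex a (sublevel K f t)"
    unfolding sublevel_def translate_complex_def by blast
  have "(\<lambda>x. x + a) ` S = {} \<or> lower_star f ((\<lambda>x. x + a) ` S) < t + h
      \<longleftrightarrow> S = {} \<or> lower_star f S < t" if "S \<in> K" for S
    using shift[OF that] by (cases "S = {}") simp_all
  then show "strict_sublevel (translate_complex a K) f (t + h)
      = translate_complex a (strict_sublevel K f t)"
    unfolding strict_sublevel_def translate_complex_def by blast
qed

lemma multiplicity_translate:
  assumes "simplicial_complex_on V K" "\<And>x. f (x + a) = f x + h"
  shows "finite_multiplicity F k (translate_complex a K) f (s + h) (t + h)
      = finite_multiplicity F k K f s t"
    and "essential_multiplicity F k (translate_complex a K) f (s + h)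
      = essential_multiplicity F k K f s"
  by (simp_all add: finite_multiplicity_def essential_multiplicity_def
      sublevel_translate[where f = f and a = a and h = h, OF assms] persistent_betti_translate)

lemma image_mset_sum:
  "image_mset g (\<Sum>i\<in>I. A i) = (\<Sum>i\<in>I. image_mset g (A i))"
  by (induction I rule: infinite_finite_induct) simp_all

text \<open>
  All values of the height function on vertices move by \<open>h\<close>, so the sums over birth and death times
  can be reindexed by \<open>s \<mapsto> s + h\<close>. The death time given to essential classes, the maximum height,
  moves along.
\<close>

lemma persistence_diagram_translate:
  assumes "simplicial_complex_on V K" "\<And>x. f (x + a) = f x + h"
  shows "persistence_diagram F k ((\<lambda>x. x + a) ` V) (translate_complex a K) f
    = image_mset (\<lambda>(b, d). (b + h, d + h)) (persistence_diagram F k V K f)"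
proof -
  have fin: "finite V"
    using assms(1) by (simp add: simplicial_complex_on_def)
  have values_eq: "f ` (\<lambda>x. x + a) ` V = (\<lambda>s. s + h) ` f ` V"
    by (simp add: image_image assms(2))
  have shift: "(\<Sum>s\<in>(\<lambda>s. s + h) ` A. g s) = (\<Sum>s\<in>A. g (s + h))"
    for A and g :: "real \<Rightarrow> (real \<times> real) multiset"
    by (subst sum.reindex) (auto simp: inj_on_def)
  have later: "{t \<in> (\<lambda>s. s + h) ` f ` V. s + h < t} = (\<lambda>s. s + h) ` {t \<in> f ` V. s < t}" for s
    by auto
  have last: "Max ((\<lambda>s. s + h) ` f ` V) = Max (f ` V) + h" if "V \<noteq> {}"
    using Max_add_commute[of "f ` V" "\<lambda>s. s" h] fin that by simp
  show ?thesis
    \<comment> \<open>The maximum height is meaningful only if there is a vertex.\<close>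
  proof (cases "V = {}")
    case True
    then show ?thesis by (simp add: persistence_diagram_def)
  next
    case False
    then show ?thesis
      unfolding persistence_diagram_def values_eq shift later last[OF False]
      by (simp add: multiplicity_translate[where f = f and a = a and h = h, OF assms] image_mset_sum)
  qed
qed

section \<open>Invariance of persistent entropy\<close>

lemma persistent_entropy_shift:
  "persistent_entropy (image_mset (\<lambda>(b, d). (b + h, d + h)) D) = persistent_entropy D"
  by (simp add: persistent_entropy_def Let_def image_mset.compositionality comp_def case_prod_unfold)

theorem proposition2:
  fixes V :: "(real ^ 'd) set" and K :: "(real ^ 'd) set set" and a :: "real ^ 'd" and k :: nat
  assumes "simplicial_complex_on V K" and "k \<le> CARD('d)"
  shows "PET TYPE('f::field) k ((\<lambda>x. x + a) ` V) (translate_complex a K) = PET TYPE('f) k V K"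
proof -
  have "persistence_diagram TYPE('f) k ((\<lambda>x. x + a) ` V) (translate_complex a K) (\<lambda>x. x \<bullet> v)
      = image_mset (\<lambda>(b, d). (b + a \<bullet> v, d + a \<bullet> v))
          (persistence_diagram TYPE('f) k V K (\<lambda>x. x \<bullet> v))" for v
    using assms(1) by (rule persistence_diagram_translate) (rule inner_add_left)
  then show ?thesis
    by (simp add: PET_def persistent_entropy_shift)
qed

end
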